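(* Let $X$ be a Banach space, $Y$ a finite-dimensional subspace of $X$, and $D\subset X$ a normalized set which is total in $X$. Then $D$ is an absolutely representing family in $X$ if and only if there exists $\varepsilon>0$ such that for every $\varphi\in Y^{\bot}$ with $\|\varphi\|=1$ there exists $x\in D$ such that $|\varphi(x)|\geqslant\varepsilon$.
   Context: $X$ is a Banach space over $\mathbb{K}$ ($=\mathbb{R}$ or $\mathbb{C}$), $X^*$ is its dual. $Y^{\bot}=\{\varphi\in X^*:\varphi(y)=0\text{ for all }y\in Y\}$. A set $D\subset X$ is normalized if $\|x\|=1$ for all $x\in D$; it is total in $X$ if the closure of its linear span equals $X$. A set $D\subset X$ is an absolutely representing family in $X$ if for every $x\in X$ there exist $a_j\in\mathbb{K}$, $x_j\in D$, $j\geqslant 1$, such that $x=\sum_{j=1}^\infty a_jx_j$ and $\sum_{j=1}^\infty\|a_jx_j\|<\infty$ (finite sums, including the empty sum for $x=0$, are allowed). *)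

theory Defs
  imports "HOL-Analysis.Analysis"
begin

(* The scalar fields K = R, C: up to isometric isomorphism of normed fields,
   these are exactly the types of this class. *)
class real_or_complex = real_normed_field +
  assumes real_or_complex:
    "(\<forall>z. \<exists>r. z = r *\<^sub>R 1) \<or>
     (\<exists>i. i * i = - 1 \<and>
          (\<forall>z. \<exists>a b. z = a *\<^sub>R 1 + b *\<^sub>R i) \<and>
          (\<forall>a b. norm (a *\<^sub>R 1 + b *\<^sub>R i) = sqrt (a\<^sup>2 + b\<^sup>2)))"

instance real :: real_or_complex
  by standard auto

instance complex :: real_or_complex
proof
  have "\<forall>z. \<exists>a b. z = a *\<^sub>R 1 + b *\<^sub>R \<i>"
    by (metis complex_eq mult.commute scaleR_conv_of_real mult.right_neutral)
  moreover have "\<forall>a b. cmod (a *\<^sub>R 1 + b *\<^sub>R \<i>) = sqrt (a\<^sup>2 + b\<^sup>2)"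
    by (simp add: cmod_def)
  moreover have "\<i> * \<i> = - 1"
    by simp
  ultimately show "(\<forall>z. \<exists>r. z = r *\<^sub>R (1::complex)) \<or>
     (\<exists>i. i * i = - 1 \<and>
          (\<forall>z. \<exists>a b. z = a *\<^sub>R 1 + b *\<^sub>R i) \<and>
          (\<forall>a b. cmod (a *\<^sub>R 1 + b *\<^sub>R i) = sqrt (a\<^sup>2 + b\<^sup>2)))"
    by blast
qed

(* The type class banach only provides the underlying real Banach space; scl is the
   multiplication by scalars from K, which extends the real one. *)
locale banach_space_over = vector_space scl
  for scl :: "'k::real_or_complex \<Rightarrow> 'a::banach \<Rightarrow> 'a" +
  assumes scale_of_real: "scl (of_real r) x = r *\<^sub>R x"
    and norm_scale: "norm (scl c x) = norm c * norm x"

lemma banach_space_over_scaleR: "banach_space_over (scaleR :: real \<Rightarrow> 'a::banach \<Rightarrow> 'a)"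
  by unfold_locales (auto simp: algebra_simps)

lemma banach_space_over_complex: "banach_space_over ((*) :: complex \<Rightarrow> complex \<Rightarrow> complex)"
  by unfold_locales (auto simp: algebra_simps norm_mult scaleR_conv_of_real)

definition finite_dimensional_subspace ::
    "('k::real_or_complex \<Rightarrow> 'a::banach \<Rightarrow> 'a) \<Rightarrow> 'a set \<Rightarrow> bool" where
  "finite_dimensional_subspace scl Y \<longleftrightarrow>
     module.subspace scl Y \<and> (\<exists>B. finite B \<and> Y = module.span scl B)"

(* Bounded real-linear maps that are K-homogeneous, i.e. bounded K-linear functionals;
   the norm of the ambient type is the usual dual norm. *)
definition dual_space ::
    "('k::real_or_complex \<Rightarrow> 'a::banach \<Rightarrow> 'a) \<Rightarrow> ('a \<Rightarrow>\<^sub>L 'k) set" where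
  "dual_space scl =
     {\<phi>. \<forall>c x. blinfun_apply \<phi> (scl c x) = c * blinfun_apply \<phi> x}"

definition annihilator ::
    "('k::real_or_complex \<Rightarrow> 'a::banach \<Rightarrow> 'a) \<Rightarrow> 'a set \<Rightarrow> ('a \<Rightarrow>\<^sub>L 'k) set" where
  "annihilator scl Y = {\<phi> \<in> dual_space scl. \<forall>y\<in>Y. blinfun_apply \<phi> y = 0}"

definition normalized :: "'a::banach set \<Rightarrow> bool" where
  "normalized D \<longleftrightarrow> (\<forall>x\<in>D. norm x = 1)"

definition total_in_space ::
    "('k::real_or_complex \<Rightarrow> 'a::banach \<Rightarrow> 'a) \<Rightarrow> 'a set \<Rightarrow> bool" where
  "total_in_space scl D \<longleftrightarrow> closure (module.span scl D) = UNIV"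

(* The finite sums are a separate case so that 0 is represented even if D is empty. *)
definition absolutely_representing_family ::
    "('k::real_or_complex \<Rightarrow> 'a::banach \<Rightarrow> 'a) \<Rightarrow> 'a set \<Rightarrow> bool" where
  "absolutely_representing_family scl D \<longleftrightarrow>
     (\<forall>x. (\<exists>(n::nat) a d. (\<forall>j<n. d j \<in> D) \<and> x = (\<Sum>j<n. scl (a j) (d j))) \<or>
          (\<exists>a d. (\<forall>j::nat. d j \<in> D) \<and>
                 (\<lambda>j. scl (a j) (d j)) sums x \<and>
                 summable (\<lambda>j. norm (scl (a j) (d j)))))"

end

theory Submission imports Defs begin

text \<open>The condition on the right says that \<open>D\<close> is norming for the annihilator of \<open>Y\<close>: the norm of
  \<open>\<phi>\<close> is at most a constant times the supremum of \<open>\<bar>\<phi>\<bar>\<close> over \<open>D\<close> (\<open>norming_iff\<close>). For \<open>Y = 0\<close> it is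
  equivalent to \<open>D\<close> being absolutely representing. If \<open>D\<close> is absolutely representing, Baire's theorem
  gives a ball contained in the closure of a multiple of the absolutely convex hull of \<open>D\<close>
  (\<open>norming_if_representing\<close>). Conversely, if \<open>D\<close> is norming for the whole dual, Hahn--Banach separation
  shows that every \<open>x\<close> is within \<open>norm x / 2\<close> of a finite combination of elements of \<open>D\<close> with coefficient
  sum at most \<open>M * norm x\<close> (\<open>norming_approx\<close>), and iterating this produces an absolutely convergent series
  (\<open>representing_if_norming\<close>).

  It remains to pass from \<open>Y\<close> to \<open>0\<close>. Here the generators of \<open>Y\<close> are removed one at a time: since \<open>D\<close> is
  total, being norming for the functionals that vanish on \<open>S\<close> and at \<open>b\<close> implies being norming for those
  that vanish on \<open>S\<close> (\<open>norming_remove\<close>). No compactness or equivalence of norms on \<open>Y\<close> is needed.\<close>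

section \<open>Sublinear functionals and the Hahn--Banach theorem\<close>

text \<open>Homogeneity is only required as an inequality; it is then automatically an equality
  (\<open>sublinear_scaleR\<close>).\<close>
definition sublinear :: "('a::real_vector \<Rightarrow> real) \<Rightarrow> bool" where
  "sublinear q \<longleftrightarrow> (\<forall>x y. q (x + y) \<le> q x + q y) \<and> (\<forall>r\<ge>0. \<forall>x. q (r *\<^sub>R x) \<le> r * q x)"

lemma sublinear_add: "sublinear q \<Longrightarrow> q (x + y) \<le> q x + q y"
  by (simp add: sublinear_def)

lemma sublinear_zero: 
  assumes "sublinear q" shows "q 0 = 0"
proof -
  have "q (0 *\<^sub>R 0) \<le> 0 * q 0" using assms unfolding sublinear_def by blast
  moreover have "q (0 + 0) \<le> q 0 + q 0" using assms by (rule sublinear_add)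
  ultimately show ?thesis by simp
qed

lemma sublinear_scaleR:
  assumes "sublinear q" "r \<ge> 0" shows "q (r *\<^sub>R x) = r * q x"
proof (cases "r = 0")
  case True
  then show ?thesis using sublinear_zero[OF assms(1)] by simp
next
  case False
  have "q ((1/r) *\<^sub>R (r *\<^sub>R x)) \<le> (1/r) * q (r *\<^sub>R x)"
    using assms unfolding sublinear_def by (metis divide_nonneg_nonneg zero_le_one)
  then have "r * q x \<le> q (r *\<^sub>R x)" using False assms(2) by (simp add: field_simps)
  moreover have "q (r *\<^sub>R x) \<le> r * q x" using assms unfolding sublinear_def by blast
  ultimately show ?thesis by simp
qed

lemma le_mult_INF:
  fixes f :: "'i \<Rightarrow> real"
  assumes "S \<noteq> {}" "r \<ge> 0" "\<And>g. g \<in> S \<Longrightarrow> v \<le> r * f g"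
  shows "v \<le> r * (INF g\<in>S. f g)"
proof (cases "r = 0")
  case True
  then show ?thesis using assms by auto
next
  case False
  then have "v / r \<le> (INF g\<in>S. f g)"
    using assms by (intro cINF_greatest) (auto simp: field_simps)
  then show ?thesis using False assms(2) by (simp add: field_simps)
qed

lemma le_add_INF:
  fixes f h :: "'i \<Rightarrow> real"
  assumes "S \<noteq> {}" "T \<noteq> {}" "\<And>g k. g \<in> S \<Longrightarrow> k \<in> T \<Longrightarrow> v \<le> f g + h k"
  shows "v \<le> (INF g\<in>S. f g) + (INF k\<in>T. h k)"
proof -
  have "v - f g \<le> (INF k\<in>T. h k)" if "g \<in> S" for g
    using assms(2) assms(3)[OF that] by (intro cINF_greatest) (auto simp: algebra_simps)
  then have "v - (INF k\<in>T. h k) \<le> (INF g\<in>S. f g)"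
    using assms(1) by (intro cINF_greatest) (force simp: algebra_simps)+
  then show ?thesis by simp
qed

text \<open>The decreased functional is \<open>x \<mapsto> inf {q (x + t a) - t q a | t \<ge> 0}\<close>. Applied to a minimal
  sublinear functional it changes nothing, which shows that such a functional is odd; applied to
  a given functional \<open>q\<close> it forces \<open>u a \<ge> q a\<close> for all linear \<open>u \<le> q'\<close>.\<close>
lemma sublinear_decrease:
  assumes q: "sublinear q"
  obtains q' where "sublinear q'" "\<And>x. q' x \<le> q x" "q' (- a) \<le> - q a"
proof -
  let ?f = "\<lambda>x t. q (x + t *\<^sub>R a) - t * q a"
  define Q where "Q x = (INF t\<in>{0..}. ?f x t)" for x
  have lower: "- q (- x) \<le> ?f x t" if "t \<ge> 0" for x t
    using sublinear_add[OF q, of "x + t *\<^sub>R a" "- x"] sublinear_scaleR[OF q that, of a] by simp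
  have "bdd_below (?f x ` {0..})" for x
    using lower by (intro bdd_belowI[of _ "- q (- x)"]) auto
  then have Qle: "Q x \<le> ?f x t" if "t \<ge> 0" for x t
    unfolding Q_def using that by (intro cINF_lower) auto
  have "sublinear Q"
    unfolding sublinear_def
  proof (intro conjI allI impI)
    fix x y
    have "Q (x + y) \<le> ?f x t + ?f y s" if "t \<in> {0..}" "s \<in> {0..}" for t s
      using Qle[of "t + s" "x + y"] that sublinear_add[OF q, of "x + t *\<^sub>R a" "y + s *\<^sub>R a"]
      by (simp add: algebra_simps)
    then show "Q (x + y) \<le> Q x + Q y"
      unfolding Q_def[of x] Q_def[of y] by (intro le_add_INF) auto
  next
    fix r :: real and x assume r: "r \<ge> 0"
    have "Q (r *\<^sub>R x) \<le> r * ?f x t" if "t \<in> {0..}" for t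
      using Qle[of "r * t" "r *\<^sub>R x"] that r sublinear_scaleR[OF q r, of "x + t *\<^sub>R a"]
      by (simp add: algebra_simps)
    then show "Q (r *\<^sub>R x) \<le> r * Q x"
      unfolding Q_def[of x] using r by (intro le_mult_INF) auto
  qed
  moreover have "Q x \<le> q x" for x using Qle[of 0 x] by simp
  moreover have "Q (- a) \<le> - q a" using Qle[of 1 "- a"] sublinear_zero[OF q] by simp
  ultimately show ?thesis using that by blast
qed

lemma minimal_sublinear_exists:
  assumes p: "sublinear (p :: 'a::real_vector \<Rightarrow> real)"
  obtains m where "sublinear m" "\<And>x. m x \<le> p x"
    "\<And>q. sublinear q \<Longrightarrow> (\<And>x. q x \<le> m x) \<Longrightarrow> q = m"
proof -
  let ?A = "{q. sublinear q \<and> (\<forall>x. q x \<le> p x)}"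
  let ?P = "\<lambda>q q' :: 'a \<Rightarrow> real. \<forall>x. q' x \<le> q x"
  have "\<exists>m\<in>?A. \<forall>a\<in>?A. ?P m a \<longrightarrow> a = m"
  proof (rule predicate_Zorn)
    show "partial_order_on ?A (relation_of ?P ?A)"
      by (rule partial_order_on_relation_ofI) (auto simp: fun_eq_iff intro: order_trans intro!: order_antisym)
  next
    fix C assume C: "C \<in> Chains (relation_of ?P ?A)"
    then have sub: "\<And>q. q \<in> C \<Longrightarrow> sublinear q" and le: "\<And>q x. q \<in> C \<Longrightarrow> q x \<le> p x"
      and chain: "\<And>q q'. q \<in> C \<Longrightarrow> q' \<in> C \<Longrightarrow> ?P q q' \<or> ?P q' q"
      by (auto simp: Chains_def relation_of_def)
    show "\<exists>u\<in>?A. \<forall>a\<in>C. ?P a u"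
    \<comment> \<open>The pointwise infimum of a nonempty chain bounds it.\<close>
    proof (cases "C = {}")
      case True
      then show ?thesis using p by blast
    next
      case False
      define u where "u x = (INF q\<in>C. q x)" for x
      have "- p (- x) \<le> q x" if "q \<in> C" for q x
        using sublinear_add[OF sub[OF that], of x "- x"] sublinear_zero[OF sub[OF that]]
          le[OF that, of "- x"] by simp
      then have "bdd_below ((\<lambda>q. q x) ` C)" for x
        by (intro bdd_belowI[of _ "- p (- x)"]) auto
      then have ule: "u x \<le> q x" if "q \<in> C" for q x
        unfolding u_def using that by (intro cINF_lower) auto
      have "sublinear u"
        unfolding sublinear_def
      proof (intro conjI allI impI)
        fix x y
        have "u (x + y) \<le> q x + q' y" if qq: "q \<in> C" "q' \<in> C" for q q'
        proof -
          \<comment> \<open>The smaller of the two functionals serves at both points.\<close>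
          obtain w where "w \<in> C" "w x \<le> q x" "w y \<le> q' y"
            using chain[OF qq] qq by blast
          then show ?thesis
            using ule[of w "x + y"] sublinear_add[OF sub, of w x y] by linarith
        qed
        then show "u (x + y) \<le> u x + u y"
          unfolding u_def[of x] u_def[of y] using False by (intro le_add_INF) auto
      next
        fix r :: real and x assume r: "r \<ge> 0"
        have "u (r *\<^sub>R x) \<le> r * q x" if "q \<in> C" for q
          using ule[OF that, of "r *\<^sub>R x"] sublinear_scaleR[OF sub[OF that] r, of x] by simp
        then show "u (r *\<^sub>R x) \<le> r * u x"
          unfolding u_def[of x] using r False by (intro le_mult_INF) auto
      qed
      moreover have "u x \<le> p x" for x
        using False ule le order_trans by blast
      ultimately show ?thesis using ule by blast
    qed
  qed
  then obtain m where m: "m \<in> ?A" "\<And>a. a \<in> ?A \<Longrightarrow> ?P m a \<Longrightarrow> a = m" by blast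
  show ?thesis
  proof (rule that)
    show "sublinear m" "m x \<le> p x" for x using m(1) by auto
    show "q = m" if "sublinear q" "\<And>x. q x \<le> m x" for q
      using m(1) that by (intro m(2)) (auto intro: order_trans)
  qed
qed

text \<open>A minimal sublinear functional is odd, and an odd sublinear functional is linear.\<close>
lemma hahn_banach_sublinear:
  assumes p: "sublinear (p :: 'a::real_vector \<Rightarrow> real)"
  obtains u where "linear u" "\<And>x. u x \<le> p x" "u x0 = p x0"
proof -
  \<comment> \<open>Lowering the value at \<open>- x0\<close> first forces \<open>u x0 \<ge> p x0\<close> for every linear \<open>u \<le> p'\<close>.\<close>
  obtain p' where p': "sublinear p'" "\<And>x. p' x \<le> p x" "p' (- x0) \<le> - p x0"
    using sublinear_decrease[OF p] by blast
  obtain u where u: "sublinear u" "\<And>x. u x \<le> p' x"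
    and min: "\<And>q. sublinear q \<Longrightarrow> (\<And>x. q x \<le> u x) \<Longrightarrow> q = u"
    using minimal_sublinear_exists[OF p'(1)] by blast
  have odd: "u (- a) = - u a" for a
  proof -
    obtain q where "sublinear q" "\<And>x. q x \<le> u x" "q (- a) \<le> - u a"
      using sublinear_decrease[OF u(1)] by blast
    then have "u (- a) \<le> - u a" using min by blast
    moreover have "0 \<le> u a + u (- a)"
      using sublinear_add[OF u(1), of a "- a"] sublinear_zero[OF u(1)] by simp
    ultimately show ?thesis by simp
  qed
  have "linear u"
  proof (rule linearI)
    fix x y
    have "u (- x + - y) \<le> u (- x) + u (- y)" by (rule sublinear_add[OF u(1)])
    then have "u x + u y \<le> u (x + y)" using odd[of "x + y"] odd by simp
    then show "u (x + y) = u x + u y" using sublinear_add[OF u(1), of x y] by simp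
  next
    fix r :: real and x
    show "u (r *\<^sub>R x) = r *\<^sub>R u x"
    proof (cases "r \<ge> 0")
      case True
      then show ?thesis using sublinear_scaleR[OF u(1)] by simp
    next
      case False
      then show ?thesis using sublinear_scaleR[OF u(1), of "- r" x] odd[of "r *\<^sub>R x"] by simp
    qed
  qed
  moreover have "u x \<le> p x" for x using u(2) p'(2) order_trans by blast
  moreover have "u x0 = p x0"
    using u(2)[of "- x0"] p'(3) odd[of x0] calculation(2)[of x0] by simp
  ultimately show ?thesis using that by blast
qed

section \<open>Functionals over the scalar field\<close>

context banach_space_over
begin

lemma scl_scaleR: "scl c (r *\<^sub>R x) = r *\<^sub>R scl c x"
  by (metis scale_of_real scale_left_commute)

lemma scaleR_scalar: "scl (r *\<^sub>R c) x = r *\<^sub>R scl c x"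
  by (metis scale_of_real scale_scale scaleR_conv_of_real)

text \<open>Every real-linear functional is the real part of a \<open>K\<close>-linear one: the functional itself in
  the real case, \<open>x \<mapsto> u x - i u (i x)\<close> in the complex case. Since the abstract scalar field has no real
  part, only the two consequences used below are recorded.\<close>
lemma functional_with_real_part:
  assumes u: "linear (u :: 'a \<Rightarrow> real)"
  obtains f :: "'a \<Rightarrow> 'k" where "linear f" "\<And>c x. f (scl c x) = c * f x"
    "\<And>x. \<bar>u x\<bar> \<le> norm (f x)" "\<And>x. f x \<in> range of_real \<Longrightarrow> norm (f x) = \<bar>u x\<bar>"
proof -
  interpret u: linear u by fact
  consider (real) "\<forall>z::'k. \<exists>r. z = r *\<^sub>R 1"
    | (complex) i :: 'k where "i * i = - 1" "\<forall>z::'k. \<exists>a b. z = a *\<^sub>R 1 + b *\<^sub>R i"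
          "\<forall>a b. norm (a *\<^sub>R 1 + b *\<^sub>R i) = sqrt (a\<^sup>2 + b\<^sup>2)"
    using real_or_complex by blast
  then show ?thesis
  proof cases
    case real
    show ?thesis
    proof (rule that[of "\<lambda>x. of_real (u x)"])
      show "linear (\<lambda>x. of_real (u x) :: 'k)"
        by (rule linearI) (simp_all add: u.add u.scale scaleR_conv_of_real)
      show "(of_real (u (scl c x)) :: 'k) = c * of_real (u x)" for c x
        using real[rule_format, of c]
        by (metis mult_scaleR_left mult_1 of_real_def scale_of_real scaleR_conv_of_real
            u.scale real_scaleR_def of_real_mult)
    qed auto
  next
    case complex
    note i = complex(1) and ex = complex(2) and nrm = complex(3)
    define f where "f x = u x *\<^sub>R 1 + (- u (scl i x)) *\<^sub>R i" for x
    have nf: "norm (f x) = sqrt ((u x)\<^sup>2 + (u (scl i x))\<^sup>2)" for x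
      unfolding f_def using nrm[rule_format, of "u x" "- u (scl i x)"] by simp
    have lin: "linear f"
      by (rule linearI)
        (simp_all add: f_def u.add u.scale scale_right_distrib scl_scaleR algebra_simps)
    have fi: "f (scl i x) = i * f x" for x
    proof -
      have "scl i (scl i x) = - x" using i by simp
      then have "f (scl i x) = u (scl i x) *\<^sub>R 1 + u x *\<^sub>R i"
        by (simp add: f_def u.neg)
      also have "\<dots> = i * f x" by (simp add: f_def algebra_simps i)
      finally show ?thesis .
    qed
    show ?thesis
    proof (rule that[of f])
      show "linear f" by (rule lin)
      show "f (scl c x) = c * f x" for c x
      proof -
        obtain a b where c: "c = a *\<^sub>R 1 + b *\<^sub>R i" using ex by blast
        have "f (scl c x) = f (a *\<^sub>R x + b *\<^sub>R scl i x)"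
          by (simp add: c scale_left_distrib scaleR_scalar)
        also have "\<dots> = a *\<^sub>R f x + b *\<^sub>R f (scl i x)"
          using lin by (simp add: linear_add linear_scale)
        also have "\<dots> = c * f x" by (simp add: fi c algebra_simps)
        finally show ?thesis .
      qed
      show "\<bar>u x\<bar> \<le> norm (f x)" for x
        unfolding nf by (metis real_sqrt_abs real_sqrt_le_mono le_add_same_cancel1 zero_le_power2)
      show "norm (f x) = \<bar>u x\<bar>" if real: "f x \<in> range of_real" for x
      proof -
        obtain r where "f x = of_real r" using real by blast
        then have "(u x - r) *\<^sub>R 1 + (- u (scl i x)) *\<^sub>R i = 0"
          by (simp add: f_def of_real_def algebra_simps)
        then have "sqrt ((u x - r)\<^sup>2 + (- u (scl i x))\<^sup>2) = 0"
          by (metis nrm norm_zero)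
        then have "u (scl i x) = 0" by (simp add: sum_power2_eq_zero_iff)
        then show ?thesis unfolding nf by simp
      qed
    qed
  qed
qed

text \<open>The Hahn--Banach theorem for a seminorm that is dominated by the norm.\<close>
lemma hahn_banach_seminorm:
  assumes add: "\<And>x y. p (x + y) \<le> p x + p y"
    and hom: "\<And>c x. p (scl c x) \<le> norm c * p x"
    and le: "\<And>x. p x \<le> norm x"
  obtains \<phi> where "\<phi> \<in> dual_space scl" "norm \<phi> \<le> 1"
    "\<And>x. norm (blinfun_apply \<phi> x) \<le> p x" "p x0 \<le> norm (blinfun_apply \<phi> x0)"
proof -
  have "p (r *\<^sub>R x) \<le> r * p x" if "r \<ge> 0" for r x
    using hom[of "of_real r" x] that by (simp add: scale_of_real)
  then have "sublinear p" using add by (simp add: sublinear_def)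
  then obtain u where u: "linear u" "\<And>x. u x \<le> p x" "u x0 = p x0"
    using hahn_banach_sublinear by blast
  obtain f where f: "linear f" "\<And>c x. f (scl c x) = c * f x"
    "\<And>x. \<bar>u x\<bar> \<le> norm (f x)" "\<And>x. f x \<in> range of_real \<Longrightarrow> norm (f x) = \<bar>u x\<bar>"
    using functional_with_real_part[OF u(1)] by blast
  have fp: "norm (f x) \<le> p x" for x
  proof (cases "f x = 0")
    case True
    have "p 0 \<le> p x + p (- x)" using add[of x "- x"] by simp
    moreover have "p (- x) \<le> p x" using hom[of "-1" x] by simp
    moreover have "p 0 \<ge> 0" using add[of 0 0] by simp
    ultimately show ?thesis using True by simp
  next
    case False
    \<comment> \<open>Rotating \<open>x\<close> by a unimodular scalar makes the value of \<open>f\<close> real.\<close>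
    define c where "c = of_real (norm (f x)) / f x"
    have c: "norm c = 1" using False by (simp add: c_def norm_divide)
    have fc: "f (scl c x) = of_real (norm (f x))" using False by (simp add: f(2) c_def)
    have "norm (f x) = norm (f (scl c x))" using fc by simp
    also have "\<dots> = \<bar>u (scl c x)\<bar>" using fc by (intro f(4)) auto
    also have "\<dots> \<le> p (scl c x)"
    proof -
      have "- u (scl c x) = u (scl (-1) (scl c x))"
        using u(1) by (simp add: linear_neg)
      also have "\<dots> \<le> p (scl (-1) (scl c x))" by (rule u(2))
      also have "\<dots> \<le> p (scl c x)" using hom[of "-1" "scl c x"] by simp
      finally show ?thesis using u(2)[of "scl c x"] by simp
    qed
    also have "\<dots> \<le> p x" using hom[of c x] c by simp
    finally show ?thesis .
  qed
  have fn: "norm (f x) \<le> norm x" for x using fp le order_trans by blast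
  have bl: "bounded_linear f"
    using f(1) fn by (intro bounded_linear_intro[of f 1]) (auto simp: linear_add linear_scale)
  let ?\<phi> = "Blinfun f"
  have ap: "blinfun_apply ?\<phi> = f" by (rule bounded_linear_Blinfun_apply[OF bl])
  show ?thesis
  proof (rule that[of ?\<phi>])
    show "?\<phi> \<in> dual_space scl" by (simp add: dual_space_def ap f(2))
    show "norm ?\<phi> \<le> 1" by (rule norm_blinfun_bound) (simp_all add: ap fn)
    show "norm (blinfun_apply ?\<phi> x) \<le> p x" for x by (simp add: ap fp)
    show "p x0 \<le> norm (blinfun_apply ?\<phi> x0)" using f(3)[of x0] u(3) by (simp add: ap)
  qed
qed

text \<open>\<open>G z s\<close> reads "\<open>z\<close> is available at cost \<open>s\<close>". The gauge \<open>p x = inf {s + norm (x - z) | G z s}\<close> is a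
  seminorm below the norm, and the functional comes from the Hahn--Banach theorem for \<open>p\<close>. Both
  separation arguments below are instances of this lemma.\<close>
lemma gauge_duality:
  assumes zero: "G 0 0"
    and nonneg: "\<And>z s. G z s \<Longrightarrow> s \<ge> (0::real)"
    and add: "\<And>z s w t. G z s \<Longrightarrow> G w t \<Longrightarrow> G (z + w) (s + t)"
    and hom: "\<And>z s c. G z s \<Longrightarrow> G (scl c z) (norm c * s)"
    and below: "\<And>z s. G z s \<Longrightarrow> \<delta> \<le> s + norm (x0 - z)"
  obtains \<phi> where "\<phi> \<in> dual_space scl" "norm \<phi> \<le> 1"
    "\<And>z s. G z s \<Longrightarrow> norm (blinfun_apply \<phi> z) \<le> s" "\<delta> \<le> norm (blinfun_apply \<phi> x0)"
proof -
  let ?G = "{(z, s). G z s}"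
  let ?f = "\<lambda>x g. snd g + norm (x - fst g)"
  define p where "p x = (INF g\<in>?G. ?f x g)" for x
  have ne: "?G \<noteq> {}" using zero by blast
  have "bdd_below (?f x ` ?G)" for x
    using nonneg by (intro bdd_belowI[of _ 0]) force
  then have ple: "p x \<le> s + norm (x - z)" if "G z s" for x z s
    unfolding p_def using cINF_lower[of "?f x" ?G "(z, s)"] that by simp
  have p_add: "p (x + y) \<le> p x + p y" for x y
  proof -
    have "p (x + y) \<le> ?f x g + ?f y h" if "g \<in> ?G" "h \<in> ?G" for g h
    proof -
      have "G (fst g + fst h) (snd g + snd h)" using that add by auto
      from ple[OF this, of "x + y"]
      show ?thesis using norm_triangle_ineq[of "x - fst g" "y - fst h"]
        by (simp add: algebra_simps)
    qed
    then show ?thesis unfolding p_def[of x] p_def[of y] using ne by (intro le_add_INF) auto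
  qed
  have p_hom: "p (scl c x) \<le> norm c * p x" for c x
  proof -
    have "p (scl c x) \<le> norm c * ?f x g" if "g \<in> ?G" for g
    proof -
      have "G (scl c (fst g)) (norm c * snd g)" using that hom by auto
      from ple[OF this, of "scl c x"] show ?thesis
        by (simp add: norm_scale distrib_left flip: scale_right_diff_distrib)
    qed
    then show ?thesis unfolding p_def[of x] using ne by (intro le_mult_INF) auto
  qed
  have p_norm: "p x \<le> norm x" for x using ple[OF zero, of x] by simp
  obtain \<phi> where \<phi>: "\<phi> \<in> dual_space scl" "norm \<phi> \<le> 1"
    "\<And>x. norm (blinfun_apply \<phi> x) \<le> p x" "p x0 \<le> norm (blinfun_apply \<phi> x0)"
    using hahn_banach_seminorm[of p x0] p_add p_hom p_norm by blast
  have "norm (blinfun_apply \<phi> z) \<le> s" if "G z s" for z s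
    using \<phi>(3)[of z] ple[OF that, of z] by simp
  moreover have "\<delta> \<le> p x0"
    unfolding p_def using ne below by (intro cINF_greatest) auto
  ultimately show ?thesis using that \<phi> by fastforce
qed

section \<open>Finite combinations\<close>

text \<open>\<open>comb D z s\<close>: the vector \<open>z\<close> is a finite linear combination of elements of \<open>D\<close> whose
  coefficients have absolute values with sum \<open>s\<close>; elements may be repeated.\<close>
inductive comb :: "'a set \<Rightarrow> 'a \<Rightarrow> real \<Rightarrow> bool" for D where
  comb_zero: "comb D 0 0"
| comb_step: "comb D z s \<Longrightarrow> d \<in> D \<Longrightarrow> comb D (z + scl c d) (s + norm c)"

lemma comb_nonneg: "comb D z s \<Longrightarrow> s \<ge> 0"
  by (induction rule: comb.induct) auto

lemma comb_add: "comb D w t \<Longrightarrow> comb D z s \<Longrightarrow> comb D (z + w) (s + t)"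
proof (induction rule: comb.induct)
  case (comb_step w t d c)
  then show ?case using comb.comb_step[of D "z + w" "s + t" d c] by (simp add: add.assoc)
qed simp

lemma comb_scale: "comb D z s \<Longrightarrow> comb D (scl c z) (norm c * s)"
proof (induction rule: comb.induct)
  case (comb_step z s d b)
  then show ?case using comb.comb_step[of D "scl c z" "norm c * s" d "c * b"]
    by (simp add: scale_right_distrib distrib_left norm_mult)
qed (simp add: comb_zero)

lemma comb_sum:
  fixes n :: nat
  assumes "\<And>j. j < n \<Longrightarrow> d j \<in> D"
  shows "comb D (\<Sum>j<n. scl (a j) (d j)) (\<Sum>j<n. norm (a j))"
  using assms by (induction n) (auto intro: comb.intros)

lemma comb_imp_sum:
  assumes "comb D z s"
  shows "\<exists>(n::nat) a d. (\<forall>j<n. d j \<in> D) \<and> z = (\<Sum>j<n. scl (a j) (d j)) \<and> s = (\<Sum>j<n. norm (a j))"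
  using assms
proof (induction rule: comb.induct)
  case comb_zero
  then show ?case by (intro exI[of _ 0]) simp
next
  case (comb_step z s e c)
  then obtain n :: nat and a d where
    "\<forall>j<n. d j \<in> D" "z = (\<Sum>j<n. scl (a j) (d j))" "s = (\<Sum>j<n. norm (a j))" by blast
  with comb_step.hyps show ?case
    by (intro exI[of _ "Suc n"] exI[of _ "a(n := c)"] exI[of _ "d(n := e)"])
      (auto simp: less_Suc_eq)
qed

lemma comb_of_span: "z \<in> module.span scl D \<Longrightarrow> \<exists>s. comb D z s"
proof (induction rule: span_induct_alt)
  case base
  then show ?case using comb_zero by blast
next
  case (step c x y)
  then show ?case using comb_step[of D y _ x c] by (auto simp: add.commute)
qed

lemma dual_comb_bound:
  assumes "comb D z s" "\<phi> \<in> dual_space scl" "\<And>d. d \<in> D \<Longrightarrow> norm (blinfun_apply \<phi> d) \<le> r"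
  shows "norm (blinfun_apply \<phi> z) \<le> s * r"
  using assms(1)
proof (induction rule: comb.induct)
  case (comb_step z s d c)
  have "norm (blinfun_apply \<phi> (z + scl c d)) \<le> norm (blinfun_apply \<phi> z) + norm c * norm (blinfun_apply \<phi> d)"
    using assms(2) norm_triangle_ineq by (auto simp: blinfun.add_right dual_space_def simp flip: norm_mult)
  also have "\<dots> \<le> s * r + norm c * r"
    using comb_step assms(3) by (intro add_mono mult_left_mono) auto
  finally show ?case by (simp add: distrib_right)
qed (simp add: blinfun.zero_right)

section \<open>Norming sets\<close>

text \<open>\<open>norming D S\<close>: on the functionals vanishing on \<open>S\<close>, the dual norm is bounded by a constant times
  the supremum of \<open>\<bar>\<phi>\<bar>\<close> over \<open>D\<close>. The supremum is replaced by its upper bounds \<open>r\<close>, which must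
  be taken nonnegative because \<open>D\<close> may be empty.\<close>
definition norming :: "'a set \<Rightarrow> 'a set \<Rightarrow> bool" where
  "norming D S \<longleftrightarrow> (\<exists>C\<ge>0. \<forall>\<phi>\<in>annihilator scl S. \<forall>r\<ge>0.
     (\<forall>d\<in>D. norm (blinfun_apply \<phi> d) \<le> r) \<longrightarrow> norm \<phi> \<le> C * r)"

lemma annihilator_empty: "annihilator scl {} = dual_space scl"
  by (simp add: annihilator_def)

lemma annihilator_span: "annihilator scl (module.span scl S) = annihilator scl S"
proof -
  have "blinfun_apply \<phi> y = 0"
    if \<phi>: "\<phi> \<in> dual_space scl" "\<forall>x\<in>S. blinfun_apply \<phi> x = 0" and y: "y \<in> module.span scl S" for \<phi> y
    using y
    by (induction rule: span_induct_alt) (use \<phi> in \<open>auto simp: dual_space_def blinfun.add_right blinfun.zero_right\<close>)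
  then show ?thesis using span_superset by (fastforce simp: annihilator_def)
qed

lemma dual_diff_scale:
  assumes "\<phi> \<in> dual_space scl" "\<psi> \<in> dual_space scl"
  obtains \<theta> where "\<theta> \<in> dual_space scl"
    "\<And>x. blinfun_apply \<theta> x = blinfun_apply \<phi> x - c * blinfun_apply \<psi> x"
proof -
  let ?f = "\<lambda>x. blinfun_apply \<phi> x - c * blinfun_apply \<psi> x"
  have "bounded_linear ?f"
    by (intro bounded_linear_sub bounded_linear_const_mult blinfun.bounded_linear_right)
  then have ap: "blinfun_apply (Blinfun ?f) = ?f" by (rule bounded_linear_Blinfun_apply)
  show ?thesis
    by (rule that[of "Blinfun ?f"])
      (use assms in \<open>auto simp: ap dual_space_def algebra_simps\<close>)
qed

lemma annihilator_scaleR: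
  assumes "\<phi> \<in> annihilator scl S"
  shows "r *\<^sub>R \<phi> \<in> annihilator scl S"
  using assms by (auto simp: annihilator_def dual_space_def blinfun.scaleR_left)

lemma norming_iff:
  "norming D S \<longleftrightarrow> (\<exists>\<epsilon>>0. \<forall>\<phi>\<in>annihilator scl S. norm \<phi> = 1 \<longrightarrow>
       (\<exists>x\<in>D. norm (blinfun_apply \<phi> x) \<ge> \<epsilon>))" (is "_ \<longleftrightarrow> ?R")
proof
  assume "norming D S"
  then obtain C where C: "C \<ge> 0" "\<And>\<phi> r. \<phi> \<in> annihilator scl S \<Longrightarrow> r \<ge> 0 \<Longrightarrow>
     (\<forall>d\<in>D. norm (blinfun_apply \<phi> d) \<le> r) \<Longrightarrow> norm \<phi> \<le> C * r"
    unfolding norming_def by blast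
  define e where "e = 1 / (C + 1)"
  have e: "e > 0" "C * e < 1" using C(1) by (simp_all add: e_def)
  have "\<exists>x\<in>D. norm (blinfun_apply \<phi> x) \<ge> e" if "\<phi> \<in> annihilator scl S" "norm \<phi> = 1" for \<phi>
  proof (rule ccontr)
    assume "\<not> ?thesis"
    then have "\<forall>d\<in>D. norm (blinfun_apply \<phi> d) \<le> e" by force
    then have "norm \<phi> \<le> C * e" using C(2) that(1) e(1) by simp
    then show False using e(2) that(2) by simp
  qed
  then show ?R using e(1) by blast
next
  assume ?R
  then obtain e where e: "e > 0" "\<And>\<phi>. \<phi> \<in> annihilator scl S \<Longrightarrow> norm \<phi> = 1 \<Longrightarrow>
       \<exists>x\<in>D. norm (blinfun_apply \<phi> x) \<ge> e" by blast
  have "norm \<phi> \<le> (1 / e) * r"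
    if \<phi>: "\<phi> \<in> annihilator scl S" and r: "r \<ge> 0" "\<forall>d\<in>D. norm (blinfun_apply \<phi> d) \<le> r" for \<phi> r
  proof (cases "\<phi> = 0")
    case True
    then show ?thesis using r e(1) by simp
  next
    case False
    let ?\<psi> = "(1 / norm \<phi>) *\<^sub>R \<phi>"
    have "norm ?\<psi> = 1" using False by simp
    then obtain x where x: "x \<in> D" "norm (blinfun_apply ?\<psi> x) \<ge> e"
      using e(2)[of ?\<psi>] annihilator_scaleR[OF \<phi>] by blast
    then have "e * norm \<phi> \<le> norm (blinfun_apply \<phi> x)"
      using False by (simp add: blinfun.scaleR_left field_simps)
    then have "e * norm \<phi> \<le> r" using r x(1) by force
    then show ?thesis using e(1) by (simp add: field_simps)
  qed
  then show "norming D S" unfolding norming_def using e(1) by (intro exI[of _ "1/e"]) auto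
qed

lemma norming_antimono: "norming D S \<Longrightarrow> S \<subseteq> T \<Longrightarrow> norming D T"
  unfolding norming_def annihilator_def by blast

lemma separate_from_span:
  assumes "b \<notin> closure (module.span scl S)"
  obtains \<psi> \<delta> where "\<psi> \<in> annihilator scl S" "norm \<psi> \<le> 1" "\<delta> > 0"
    "norm (blinfun_apply \<psi> b) \<ge> \<delta>"
proof -
  obtain \<delta> where \<delta>: "\<delta> > 0" "\<And>y. y \<in> module.span scl S \<Longrightarrow> \<delta> \<le> dist y b"
    using assms unfolding closure_approachable by (meson not_le)
  define G where "G z s \<longleftrightarrow> z \<in> module.span scl S \<and> s = (0::real)" for z s
  obtain \<psi> where \<psi>: "\<psi> \<in> dual_space scl" "norm \<psi> \<le> 1"
    "\<And>z s. G z s \<Longrightarrow> norm (blinfun_apply \<psi> z) \<le> s" "\<delta> \<le> norm (blinfun_apply \<psi> b)"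
  proof (rule gauge_duality[of G \<delta> b])
    show "G 0 0" by (simp add: G_def span_zero)
    show "G z s \<Longrightarrow> s \<ge> 0" for z s by (simp add: G_def)
    show "G z s \<Longrightarrow> G w t \<Longrightarrow> G (z + w) (s + t)" for z s w t by (simp add: G_def span_add)
    show "G z s \<Longrightarrow> G (scl c z) (norm c * s)" for z s c by (simp add: G_def span_scale)
    show "G z s \<Longrightarrow> \<delta> \<le> s + norm (b - z)" for z s
      using \<delta>(2)[of z] by (simp add: G_def dist_norm norm_minus_commute)
  qed blast
  have "\<psi> \<in> annihilator scl S"
    using \<psi>(1) \<psi>(3)[of _ 0] span_base[of _ S] by (force simp: annihilator_def G_def)
  then show ?thesis using that \<psi> \<delta>(1) by blast
qed

text \<open>This is where totality enters. If \<open>b\<close> is not in the closed span of \<open>S\<close>, subtract from \<open>\<phi>\<close> the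
  multiple of a functional \<open>\<psi>\<close>, vanishing on \<open>S\<close> but not at \<open>b\<close>, that makes the difference vanish at
  \<open>b\<close>. The correction has size proportional to \<open>\<bar>\<phi> b\<bar>\<close>, and \<open>\<phi> b\<close> is controlled by the values of \<open>\<phi>\<close>
  on \<open>D\<close>, up to a small multiple of \<open>norm \<phi>\<close>, because \<open>b\<close> is close to a combination of elements of
  \<open>D\<close>.\<close>
lemma norming_remove:
  assumes D: "normalized D" and total: "total_in_space scl D" and nor: "norming D (insert b S)"
  shows "norming D S"
proof -
  obtain C where C: "C \<ge> 0" "\<And>\<phi> r. \<phi> \<in> annihilator scl (insert b S) \<Longrightarrow> r \<ge> 0 \<Longrightarrow>
     (\<forall>d\<in>D. norm (blinfun_apply \<phi> d) \<le> r) \<Longrightarrow> norm \<phi> \<le> C * r"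
    using nor unfolding norming_def by blast
  show ?thesis
  proof (cases "b \<in> closure (module.span scl S)")
    case True
    have "\<phi> \<in> annihilator scl (insert b S)" if \<phi>: "\<phi> \<in> annihilator scl S" for \<phi>
    proof -
      have "\<phi> \<in> annihilator scl (module.span scl S)" using \<phi> annihilator_span by blast
      then have "blinfun_apply \<phi> b = 0"
        by (intro continuous_constant_on_closure[of "module.span scl S" "blinfun_apply \<phi>" 0 b])
          (auto simp: annihilator_def True intro!: linear_continuous_on blinfun.bounded_linear_right)
      then show ?thesis using \<phi> by (simp add: annihilator_def)
    qed
    then show ?thesis using C unfolding norming_def by blast
  next
    case False
    then obtain \<psi> \<delta> where \<psi>: "\<psi> \<in> annihilator scl S" "norm \<psi> \<le> 1" "\<delta> > 0"
      "norm (blinfun_apply \<psi> b) \<ge> \<delta>"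
      using separate_from_span by blast
    \<comment> \<open>Chosen so that \<open>(C + 1) * \<eta> / \<delta> = 1 / 2\<close>: half of \<open>norm \<phi>\<close> can then be absorbed.\<close>
    define \<eta> where "\<eta> = \<delta> / (2 * (C + 1))"
    have \<eta>: "\<eta> > 0" using \<psi>(3) C(1) by (simp add: \<eta>_def)
    have "b \<in> closure (module.span scl D)" using total by (simp add: total_in_space_def)
    then obtain z where z: "z \<in> module.span scl D" "dist z b < \<eta>"
      using \<eta> unfolding closure_approachable by blast
    obtain t where t: "comb D z t" using comb_of_span[OF z(1)] by blast
    have t0: "t \<ge> 0" using comb_nonneg[OF t] .
    define C' where "C' = 2 * (C + (C + 1) * t / \<delta>)"
    have "norm \<phi> \<le> C' * r"
      if \<phi>: "\<phi> \<in> annihilator scl S" and r: "r \<ge> 0" "\<forall>d\<in>D. norm (blinfun_apply \<phi> d) \<le> r" for \<phi> r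
    proof -
      define c where "c = blinfun_apply \<phi> b / blinfun_apply \<psi> b"
      have nz: "blinfun_apply \<psi> b \<noteq> 0" using \<psi>(3,4) by auto
      obtain \<theta> where \<theta>: "\<theta> \<in> dual_space scl"
        "\<And>x. blinfun_apply \<theta> x = blinfun_apply \<phi> x - c * blinfun_apply \<psi> x"
        using dual_diff_scale[of \<phi> \<psi> c] \<phi> \<psi>(1) by (auto simp: annihilator_def)
      have \<psi>x: "norm (c * blinfun_apply \<psi> x) \<le> norm c * norm x" for x
        using norm_blinfun[of \<psi> x] \<psi>(2) mult_right_mono[OF \<psi>(2), of "norm x"]
        by (simp add: norm_mult mult_left_mono)
      have "norm \<theta> \<le> C * (r + norm c)"
      proof (rule C(2))
        show "\<theta> \<in> annihilator scl (insert b S)"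
          using \<theta> \<phi> \<psi>(1) nz by (simp add: annihilator_def c_def)
        show "0 \<le> r + norm c" using r by simp
        show "\<forall>d\<in>D. norm (blinfun_apply \<theta> d) \<le> r + norm c"
        proof
          fix d assume d: "d \<in> D"
          have "norm (blinfun_apply \<theta> d) \<le> norm (blinfun_apply \<phi> d) + norm (c * blinfun_apply \<psi> d)"
            unfolding \<theta>(2) by (rule norm_triangle_ineq4)
          also have "\<dots> \<le> r + norm c"
            using r(2) d \<psi>x[of d] D by (intro add_mono) (auto simp: normalized_def)
          finally show "norm (blinfun_apply \<theta> d) \<le> r + norm c" .
        qed
      qed
      moreover have "norm \<phi> \<le> norm \<theta> + norm c"
      proof (rule norm_blinfun_bound)
        fix x
        have "blinfun_apply \<phi> x = blinfun_apply \<theta> x + c * blinfun_apply \<psi> x" by (simp add: \<theta>(2))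
        then have "norm (blinfun_apply \<phi> x) \<le> norm (blinfun_apply \<theta> x) + norm (c * blinfun_apply \<psi> x)"
          by (simp add: norm_triangle_ineq)
        also have "\<dots> \<le> norm \<theta> * norm x + norm c * norm x"
          using \<psi>x norm_blinfun by (intro add_mono)
        finally show "norm (blinfun_apply \<phi> x) \<le> (norm \<theta> + norm c) * norm x"
          by (simp add: distrib_right)
      qed simp
      ultimately have 1: "norm \<phi> \<le> C * r + (C + 1) * norm c" by (simp add: algebra_simps)
      have "norm (blinfun_apply \<phi> b) \<le> norm (blinfun_apply \<phi> z) + norm (blinfun_apply \<phi> (b - z))"
        using norm_triangle_ineq[of "blinfun_apply \<phi> z" "blinfun_apply \<phi> (b - z)"]
        by (simp add: blinfun.diff_right)
      also have "\<dots> \<le> t * r + norm \<phi> * \<eta>"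
      proof (rule add_mono)
        show "norm (blinfun_apply \<phi> z) \<le> t * r"
          using dual_comb_bound[OF t] \<phi> r by (simp add: annihilator_def)
        have "norm (b - z) \<le> \<eta>" using z(2) by (simp add: dist_norm norm_minus_commute)
        then show "norm (blinfun_apply \<phi> (b - z)) \<le> norm \<phi> * \<eta>"
          by (meson norm_blinfun mult_left_mono norm_ge_zero order_trans)
      qed
      finally have 2: "norm (blinfun_apply \<phi> b) \<le> t * r + norm \<phi> * \<eta>" .
      have "norm c \<le> norm (blinfun_apply \<phi> b) / \<delta>"
        unfolding c_def norm_divide using \<psi>(3,4) nz by (intro divide_left_mono mult_pos_pos) auto
      also have "\<dots> \<le> (t * r + norm \<phi> * \<eta>) / \<delta>"
        using 2 \<psi>(3) by (intro divide_right_mono) auto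
      finally have "(C + 1) * norm c \<le> (C + 1) * ((t * r + norm \<phi> * \<eta>) / \<delta>)"
        using C(1) by (intro mult_left_mono) auto
      also have "\<dots> = (C + 1) * t / \<delta> * r + norm \<phi> * ((C + 1) * \<eta> / \<delta>)"
        by (simp add: add_divide_distrib algebra_simps)
      also have "(C + 1) * \<eta> / \<delta> = 1 / 2"
        using C(1) \<psi>(3) by (simp add: \<eta>_def)
      finally have 3: "(C + 1) * norm c \<le> (C + 1) * t / \<delta> * r + norm \<phi> * (1 / 2)" .
      have "C' * r = 2 * (C * r + (C + 1) * t / \<delta> * r)" by (simp add: C'_def algebra_simps)
      moreover have "n \<le> 2 * (p + q)" if "n \<le> p + X" "X \<le> q + n * (1 / 2)" for n p q X :: real
        using that by simp
      ultimately show ?thesis using 1 3 by simp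
    qed
    moreover have "C' \<ge> 0" using C(1) t0 \<psi>(3) by (simp add: C'_def)
    ultimately show ?thesis unfolding norming_def by blast
  qed
qed

lemma norming_finite_dimensional:
  assumes "normalized D" "total_in_space scl D" "finite_dimensional_subspace scl Y"
  shows "norming D Y \<longleftrightarrow> norming D {}"
proof
  obtain B where B: "finite B" "Y = module.span scl B"
    using assms(3) by (auto simp: finite_dimensional_subspace_def)
  have "norming D B \<Longrightarrow> norming D {}"
    using B(1) by (induction B rule: finite_induct) (use norming_remove assms in blast)+
  moreover assume "norming D Y"
  ultimately show "norming D {}" by (simp add: norming_def B(2) annihilator_span)
qed (erule norming_antimono, simp)

section \<open>Representing families are norming\<close>

text \<open>The space is the union over \<open>n\<close> of the closures of the combinations with coefficient sum at
  most \<open>n\<close>; by Baire's theorem one of them contains a ball, on which \<open>\<bar>\<phi>\<bar>\<close> is at most \<open>n\<close> times its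
  supremum over \<open>D\<close>.\<close>
lemma norming_if_representing:
  assumes D: "normalized D" and arf: "absolutely_representing_family scl D"
  shows "norming D {}"
proof -
  define A where "A n = closure {z. \<exists>s\<le>real n. comb D z s}" for n
  have "\<exists>n. x \<in> A n" for x
  proof -
    from arf have "(\<exists>(n::nat) a d. (\<forall>j<n. d j \<in> D) \<and> x = (\<Sum>j<n. scl (a j) (d j))) \<or>
        (\<exists>a d. (\<forall>j::nat. d j \<in> D) \<and> (\<lambda>j. scl (a j) (d j)) sums x \<and>
          summable (\<lambda>j. norm (scl (a j) (d j))))"
      unfolding absolutely_representing_family_def by (rule spec)
    then show ?thesis
    proof (elim disjE exE conjE)
      fix n :: nat and a d
      assume fin: "\<forall>j<n. d j \<in> D" "x = (\<Sum>j<n. scl (a j) (d j))"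
      obtain m where m: "(\<Sum>j<n. norm (a j)) \<le> real m" using real_arch_simple by blast
      have "comb D x (\<Sum>j<n. norm (a j))" using comb_sum[of n d D a] fin by simp
      then have "x \<in> {z. \<exists>s\<le>real m. comb D z s}" using m by blast
      then have "x \<in> A m" unfolding A_def by (rule subsetD[OF closure_subset])
      then show ?thesis ..
    next
      fix a and d :: "nat \<Rightarrow> 'a"
      assume inf: "\<forall>j. d j \<in> D" "(\<lambda>j. scl (a j) (d j)) sums x"
          "summable (\<lambda>j. norm (scl (a j) (d j)))"
      have nrm: "norm (scl (a j) (d j)) = norm (a j)" for j
        using D inf(1) by (simp add: normalized_def norm_scale)
      obtain m where m: "(\<Sum>j. norm (a j)) \<le> real m" using real_arch_simple by blast
      have "(\<Sum>j<n. norm (a j)) \<le> real m" for n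
        using sum_le_suminf[of "\<lambda>j. norm (a j)" "{..<n}"] inf(3) m by (simp add: nrm)
      then have "(\<Sum>j<n. scl (a j) (d j)) \<in> {z. \<exists>s\<le>real m. comb D z s}" for n
        using comb_sum[of n d D a] inf(1) by auto
      then have "x \<in> A m"
        using inf(2) unfolding A_def sums_def closure_sequential
        by (intro exI[of _ "\<lambda>n. \<Sum>j<n. scl (a j) (d j)"] conjI allI)
      then show ?thesis by blast
    qed
  qed
  then have un: "\<Union> (range A) = UNIV" by blast
  have "\<exists>n. interior (A n) \<noteq> {}"
  proof (rule ccontr)
    assume "\<not> ?thesis"
    then have "(euclidean :: 'a topology) interior_of \<Union> (range A) = {}"
      by (intro Baire_category_alt)
        (auto simp: completely_metrizable_space_euclidean interior_of_eq A_def)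
    then show False using un by simp
  qed
  then obtain n v where "v \<in> interior (A n)" by blast
  then obtain r where r: "r > 0" "cball v r \<subseteq> A n"
    by (auto simp: mem_interior_cball)
  have "norm \<phi> \<le> (2 * real n / r) * s"
    if \<phi>: "\<phi> \<in> annihilator scl {}" and s: "s \<ge> 0" "\<forall>d\<in>D. norm (blinfun_apply \<phi> d) \<le> s" for \<phi> s
  proof -
    have A: "norm (blinfun_apply \<phi> z) \<le> real n * s" if "z \<in> A n" for z
    proof (rule continuous_le_on_closure[of "{z. \<exists>s\<le>real n. comb D z s}" "\<lambda>z. norm (blinfun_apply \<phi> z)"])
      show "continuous_on (closure {z. \<exists>s\<le>real n. comb D z s}) (\<lambda>z. norm (blinfun_apply \<phi> z))"
        by (intro continuous_intros)
      show "z \<in> closure {z. \<exists>s\<le>real n. comb D z s}" using that by (simp add: A_def)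
      fix w assume "w \<in> {z. \<exists>s\<le>real n. comb D z s}"
      then obtain t where t: "t \<le> real n" "comb D w t" by blast
      have "norm (blinfun_apply \<phi> w) \<le> t * s"
        using dual_comb_bound[OF t(2)] \<phi> s by (simp add: annihilator_def)
      also have "\<dots> \<le> real n * s" using t(1) s(1) by (rule mult_right_mono)
      finally show "norm (blinfun_apply \<phi> w) \<le> real n * s" .
    qed
    show ?thesis
    proof (rule norm_blinfun_bound)
      show "0 \<le> 2 * real n / r * s" using r s by simp
      fix x
      show "norm (blinfun_apply \<phi> x) \<le> 2 * real n / r * s * norm x"
      proof (cases "x = 0")
        case False
        \<comment> \<open>\<open>\<phi> y\<close> is the difference of the values at the points \<open>v + y\<close> and \<open>v\<close> of the ball.\<close>
        define y where "y = (r / norm x) *\<^sub>R x"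
        have "norm y = r" using False r(1) by (simp add: y_def)
        then have "v + y \<in> A n" "v \<in> A n" using r by (auto simp: dist_norm)
        then have "norm (blinfun_apply \<phi> (v + y)) \<le> real n * s" "norm (blinfun_apply \<phi> v) \<le> real n * s"
          using A by blast+
        then have "norm (blinfun_apply \<phi> y) \<le> 2 * real n * s"
          using norm_triangle_ineq4[of "blinfun_apply \<phi> (v + y)" "blinfun_apply \<phi> v"]
          by (simp add: blinfun.add_right)
        then have "(r / norm x) * norm (blinfun_apply \<phi> x) \<le> 2 * real n * s"
          using r(1) by (simp add: y_def blinfun.scaleR_right)
        then show ?thesis using r(1) False by (simp add: field_simps)
      qed simp
    qed
  qed
  moreover have "2 * real n / r \<ge> 0" using r(1) by simp
  ultimately show ?thesis unfolding norming_def by blast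
qed

section \<open>Norming sets are representing families\<close>

text \<open>Otherwise the duality lemma, with cost \<open>m\<close> times the coefficient sum, gives a functional that is
  at most \<open>m\<close> on \<open>D\<close> but at least \<open>norm x / 2\<close> at \<open>x\<close>, which is too large when \<open>C * m \<le> 1 / 4\<close>.\<close>
lemma norming_approx:
  assumes "norming D {}"
  obtains M where "M > 0" "\<And>x. \<exists>z s. comb D z s \<and> s \<le> M * norm x \<and> norm (x - z) \<le> norm x / 2"
proof -
  obtain C where C: "C \<ge> 0" "\<And>\<phi> r. \<phi> \<in> dual_space scl \<Longrightarrow> r \<ge> 0 \<Longrightarrow>
     (\<forall>d\<in>D. norm (blinfun_apply \<phi> d) \<le> r) \<Longrightarrow> norm \<phi> \<le> C * r"
    using assms unfolding norming_def annihilator_empty by blast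
  define m where "m = 1 / (4 * (C + 1))"
  have m: "m > 0" "C * m \<le> 1 / 4" using C(1) by (simp_all add: m_def field_simps)
  have "\<exists>z s. comb D z s \<and> s \<le> 1 / m * norm x \<and> norm (x - z) \<le> norm x / 2" for x
  proof (cases "x = 0")
    case True
    then show ?thesis using comb_zero by (intro exI[of _ 0]) simp
  next
    case False
    have "\<exists>z s. comb D z s \<and> m * s + norm (x - z) < norm x / 2"
    proof (rule ccontr)
      assume far: "\<not> ?thesis"
      define G where "G z s \<longleftrightarrow> (\<exists>t. comb D z t \<and> s = m * t)" for z s
      obtain \<phi> where \<phi>: "\<phi> \<in> dual_space scl"
        "\<And>z s. G z s \<Longrightarrow> norm (blinfun_apply \<phi> z) \<le> s" "norm x / 2 \<le> norm (blinfun_apply \<phi> x)"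
      proof (rule gauge_duality[of G "norm x / 2" x])
        show "G 0 0" using comb_zero by (force simp: G_def)
        show "G z s \<Longrightarrow> s \<ge> 0" for z s using comb_nonneg m(1) by (auto simp: G_def)
        show "G z s \<Longrightarrow> G w t \<Longrightarrow> G (z + w) (s + t)" for z s w t
          unfolding G_def using comb_add by (metis distrib_left)
        show "G z s \<Longrightarrow> G (scl c z) (norm c * s)" for z s c
          unfolding G_def using comb_scale by (metis mult.left_commute)
        show "G z s \<Longrightarrow> norm x / 2 \<le> s + norm (x - z)" for z s
          unfolding G_def using far by force
      qed blast
      have "norm (blinfun_apply \<phi> d) \<le> m" if "d \<in> D" for d
        using \<phi>(2)[of d m] comb_step[OF comb_zero that, of 1] by (auto simp: G_def)
      then have "norm \<phi> \<le> C * m" using C(2)[OF \<phi>(1)] m(1) by simp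
      then have "norm \<phi> \<le> 1 / 4" using m(2) by simp
      then have "norm \<phi> * norm x \<le> norm x / 4" using mult_right_mono[of "norm \<phi>" "1/4" "norm x"] by simp
      then have "norm (blinfun_apply \<phi> x) \<le> norm x / 4" using norm_blinfun[of \<phi> x] by simp
      then show False using \<phi>(3) zero_less_norm_iff[of x] False by linarith
    qed
    then obtain z s where z: "comb D z s" "m * s + norm (x - z) < norm x / 2" by blast
    have "m * s \<ge> 0" using comb_nonneg[OF z(1)] m(1) by simp
    then have "norm (x - z) \<le> norm x / 2" using z(2) by linarith
    moreover have "m * s \<le> norm x" using z(2) norm_ge_zero[of "x - z"] norm_ge_zero[of x] by linarith
    then have "s \<le> 1 / m * norm x" using m(1) by (simp add: field_simps)
    ultimately show ?thesis using z(1) by blast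
  qed
  then show ?thesis using that[of "1 / m"] m(1) by simp
qed

text \<open>A convergent series of finite combinations with summable coefficient sums can be rewritten as one
  series over \<open>D\<close>: each combination is padded with zero coefficients to a sequence, and the resulting
  absolutely summable double family is enumerated along \<open>\<nat> \<times> \<nat>\<close>.\<close>
lemma series_of_combs:
  assumes D: "normalized D" "D \<noteq> {}"
    and z: "\<And>n::nat. comb D (z n) (s n)" "summable s" "z sums x"
  obtains a d where "\<forall>j::nat. d j \<in> D" "(\<lambda>j. scl (a j) (d j)) sums x"
    "summable (\<lambda>j. norm (scl (a j) (d j)))"
proof -
  obtain d0 where d0: "d0 \<in> D" using D(2) by blast
  have "\<exists>(N::nat) a d. (\<forall>j. d j \<in> D) \<and> (\<forall>j\<ge>N. a j = 0)
      \<and> z n = (\<Sum>j<N. scl (a j) (d j)) \<and> s n = (\<Sum>j<N. norm (a j))" for n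
  proof -
    obtain N :: nat and a :: "nat \<Rightarrow> 'k" and d where "\<forall>j<N. d j \<in> D" "z n = (\<Sum>j<N. scl (a j) (d j))" "s n = (\<Sum>j<N. norm (a j))"
      using comb_imp_sum[OF z(1)] by blast
    then show ?thesis
      by (intro exI[of _ N] exI[of _ "\<lambda>j. if j < N then a j else 0"] exI[of _ "\<lambda>j. if j < N then d j else d0"])
        (auto simp: d0)
  qed
  then obtain N :: "nat \<Rightarrow> nat" and a :: "nat \<Rightarrow> nat \<Rightarrow> 'k" and d :: "nat \<Rightarrow> nat \<Rightarrow> 'a"
    where d: "\<And>n j. d n j \<in> D" and a: "\<And>n j. j \<ge> N n \<Longrightarrow> a n j = 0"
    and zn: "\<And>n. z n = (\<Sum>j<N n. scl (a n j) (d n j))" and sn: "\<And>n. s n = (\<Sum>j<N n. norm (a n j))"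
    by metis
  define f where "f n j = scl (a n j) (d n j)" for n j
  have nf: "norm (f n j) = norm (a n j)" for n j
    using D(1) d by (simp add: f_def norm_scale normalized_def)
  have fz: "(f n has_sum z n) UNIV" for n
  proof -
    have "(f n has_sum sum (f n) {..<N n}) UNIV"
      by (rule has_sum_finite_neutralI) (auto simp: f_def a)
    then show ?thesis by (simp add: zn f_def)
  qed
  have fs: "((\<lambda>j. norm (f n j)) has_sum s n) UNIV" for n
  proof -
    have "((\<lambda>j. norm (a n j)) has_sum (\<Sum>j<N n. norm (a n j))) UNIV"
      by (rule has_sum_finite_neutralI) (auto simp: a)
    then show ?thesis by (simp add: sn nf)
  qed
  let ?g = "\<lambda>(n, j). f n j"
  have s0: "s n \<ge> 0" for n using comb_nonneg[OF z(1)] .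
  have abs: "(\<lambda>p. norm (?g p)) summable_on UNIV \<times> UNIV"
  proof (rule Infinite_Sum.abs_summable_on_Sigma_iff[where f = ?g and A = UNIV and B = "\<lambda>_. UNIV", THEN iffD2], intro conjI ballI)
    show "(\<lambda>j. norm (case (n, j) of (n, j) \<Rightarrow> f n j)) summable_on UNIV" for n
      using fs[of n] by (auto simp: summable_on_def)
    have "infsum (\<lambda>j. norm (f n j)) UNIV = s n" for n using fs by (rule infsumI)
    then show "(\<lambda>n. norm (infsum (\<lambda>j. norm (case (n, j) of (n, j) \<Rightarrow> f n j)) UNIV)) summable_on UNIV"
      using z(2) s0 by (simp add: summable_on_UNIV_nonneg_real_iff)
  qed
  have gs: "?g summable_on UNIV \<times> UNIV" using abs by (rule Infinite_Sum.abs_summable_summable)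
  have nz: "norm (z n) \<le> s n" for n
    unfolding zn sn using nf by (intro sum_norm_le) (simp add: f_def)
  have "summable (\<lambda>n. norm (z n))"
    by (rule summable_comparison_test'[OF z(2), of 0]) (simp add: nz)
  then have zx: "(z has_sum x) UNIV" using z(3) by (intro norm_summable_imp_has_sum)
  have "infsum ?g (UNIV \<times> UNIV) = infsum (\<lambda>n. infsum (f n) UNIV) UNIV"
    using infsum_Sigma'_banach[of f UNIV "\<lambda>_. UNIV"] gs by simp
  also have "\<dots> = infsum z UNIV" using infsumI[OF fz] by simp
  also have "\<dots> = x" using zx by (rule infsumI)
  finally have gx: "(?g has_sum x) UNIV" using has_sum_infsum[OF gs] by simp
  have bij: "bij_betw prod_decode UNIV UNIV" by (rule bij_prod_decode)
  define h where "h k = ?g (prod_decode k)" for k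
  have hx: "(h has_sum x) UNIV"
    unfolding h_def using has_sum_reindex_bij_betw[OF bij, of ?g x] gx by simp
  have hs: "(\<lambda>k. norm (h k)) summable_on UNIV"
    unfolding h_def using summable_on_reindex_bij_betw[OF bij, of "\<lambda>p. norm (?g p)"] abs by simp
  have he: "h k = scl (case_prod a (prod_decode k)) (case_prod d (prod_decode k))" for k
    by (simp add: h_def f_def split: prod.split)
  show ?thesis
  proof (rule that[of "\<lambda>k. case_prod d (prod_decode k)" "\<lambda>k. case_prod a (prod_decode k)"])
    show "\<forall>k. case_prod d (prod_decode k) \<in> D" by (simp add: d split: prod.split)
  qed (use hx hs has_sum_imp_sums summable_on_imp_summable in \<open>auto simp flip: he\<close>)
qed

lemma representing_if_norming:
  assumes D: "normalized D" and total: "total_in_space scl D" and nor: "norming D {}"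
  shows "absolutely_representing_family scl D"
proof (cases "D = {}")
  case True
  have "x = 0" for x :: 'a using total True by (simp add: total_in_space_def) blast
  then show ?thesis unfolding absolutely_representing_family_def by (metis lessThan_0 not_less0 sum.empty)
next
  case False
  obtain M where M: "M > 0" "\<And>x. \<exists>z s. comb D z s \<and> s \<le> M * norm x \<and> norm (x - z) \<le> norm x / 2"
    using norming_approx[OF nor] by blast
  then obtain Z S where ZS: "\<And>x. comb D (Z x) (S x)" "\<And>x. S x \<le> M * norm x"
    "\<And>x. norm (x - Z x) \<le> norm x / 2" by metis
  have "\<exists>a d. (\<forall>j::nat. d j \<in> D) \<and> (\<lambda>j. scl (a j) (d j)) sums x \<and>
                 summable (\<lambda>j. norm (scl (a j) (d j)))" for x
  proof -
    \<comment> \<open>The remainders of the successive approximations; they at least halve at each step.\<close>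
    define y where "y n = ((\<lambda>v. v - Z v) ^^ n) x" for n
    have ySuc: "y (Suc n) = y n - Z (y n)" for n by (simp add: y_def)
    have yn: "norm (y n) \<le> norm x * (1 / 2) ^ n" for n
    proof (induction n)
      case (Suc n)
      then show ?case using ZS(3)[of "y n"] by (simp add: ySuc)
    qed (simp add: y_def)
    have geo: "summable (\<lambda>n. norm x * (1 / 2 :: real) ^ n)" by (intro summable_mult summable_geometric) simp
    have y0: "y \<longlonglongrightarrow> 0"
      by (rule Lim_null_comparison[OF _ summable_LIMSEQ_zero[OF geo]]) (simp add: yn)
    have "(\<Sum>j<n. Z (y j)) = x - y n" for n
      by (induction n) (simp_all add: ySuc, simp add: y_def)
    then have "(\<lambda>n. Z (y n)) sums x"
      unfolding sums_def using tendsto_diff[OF tendsto_const y0, of x] by simp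
    moreover have "summable (\<lambda>n. S (y n))"
    proof (rule summable_comparison_test'[of _ 0])
      show "summable (\<lambda>n. M * (norm x * (1 / 2) ^ n))" using geo by (rule summable_mult)
      show "norm (S (y n)) \<le> M * (norm x * (1 / 2) ^ n)" for n
        using ZS(2)[of "y n"] comb_nonneg[OF ZS(1)[of "y n"]] mult_left_mono[OF yn[of n], of M] M(1)
        unfolding real_norm_def by linarith
    qed
    ultimately show ?thesis
      using series_of_combs[OF D False, of "\<lambda>n. Z (y n)" "\<lambda>n. S (y n)" x] ZS(1) by metis
  qed
  then show ?thesis unfolding absolutely_representing_family_def by blast
qed

end

section \<open>The characterization\<close>

theorem mainTheorem8:
  fixes scl :: "'k::real_or_complex \<Rightarrow> 'a::banach \<Rightarrow> 'a"
    and Y D :: "'a set"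
  assumes "banach_space_over scl"
    and "finite_dimensional_subspace scl Y"
    and "normalized D"
    and "total_in_space scl D"
  shows "absolutely_representing_family scl D \<longleftrightarrow>
    (\<exists>\<epsilon>>0. \<forall>\<phi>\<in>annihilator scl Y. norm \<phi> = 1 \<longrightarrow>
       (\<exists>x\<in>D. norm (blinfun_apply \<phi> x) \<ge> \<epsilon>))"
proof -
  interpret banach_space_over scl by fact
  have "absolutely_representing_family scl D \<longleftrightarrow> norming D {}"
    using norming_if_representing representing_if_norming assms(3,4) by blast
  also have "\<dots> \<longleftrightarrow> norming D Y"
    using norming_finite_dimensional assms(2-4) by blast
  finally show ?thesis unfolding norming_iff .
qed

end
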